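(* Let $p\in(1,\infty)$, $\theta\in(0,\infty)$, $\sigma\in(\theta,1+\theta)$, $\mathfrak{B}\in C^0(\overline{B_1};\mathbb{R}^n)$, $\varrho\in C^0(\overline{B_1})$ and $f\in L^\infty(B_1)\cap C^0(B_1)$. Let $u\in C^0(B_1)$ be a bounded viscosity solution of $$|\nabla u|^{\theta}\Delta_p^{\mathrm N}u+\langle\mathfrak{B}(x),\nabla u\rangle|\nabla u|^{\theta}+\varrho(x)|\nabla u|^{\sigma}=f(x)\quad\text{in }B_1.$$ Assume that $\inf_{B_1}f\ge\mathfrak{c}_0$ for some constant $\mathfrak{c}_0>0$. Then there is a constant $C>0$, depending only on $n$, $p$, $\theta$, $\sigma$, $\|\mathfrak{B}\|_{L^\infty(B_1;\mathbb{R}^n)}$, $\|\varrho\|_{L^\infty(B_1)}$ and $\mathfrak{c}_0$, such that for any local extremum point $x_0\in B_1$ of $u$ and every $r>0$ with $\overline{B_r(x_0)}\subset B_1$, $$\sup_{\partial B_r(x_0)}\left(u-u(x_0)\right)\ge C\,r^{1+\frac{1}{1+\theta}}.$$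
   Context: $B_r(x_0)$ is the open ball of radius $r$ centered at $x_0\in\mathbb{R}^n$, and $B_r=B_r(0)$. The normalized $p$-Laplacian is $\Delta_p^{\mathrm N}u=\Delta u+(p-2)\left\langle D^2u\frac{\nabla u}{|\nabla u|},\frac{\nabla u}{|\nabla u|}\right\rangle$. Write $H(\xi,x)=\langle\mathfrak{B}(x),\xi\rangle|\xi|^\theta+\varrho(x)|\xi|^\sigma$. For a symmetric matrix $X$, $\lambda_{\max}(X)$ and $\lambda_{\min}(X)$ denote its largest and smallest eigenvalues. Viscosity solutions: a continuous function $u$ is a viscosity subsolution (respectively supersolution) of $|\nabla u|^\theta\Delta_p^{\mathrm N}u+H(\nabla u,x)=f(x)$ in $\Omega$ if, whenever $\phi\in C^2(\Omega)$ and $u-\phi$ has a local maximum (respectively minimum) at $x_0\in\Omega$: (1) if $\nabla\phi(x_0)\neq0$, then $|\nabla\phi(x_0)|^\theta\Delta_p^{\mathrm N}\phi(x_0)+H(\nabla\phi(x_0),x_0)\ge f(x_0)$ (respectively $\le f(x_0)$); (2) if $\nabla\phi(x_0)=0$ and $p\ge2$, then $\Delta\phi(x_0)+(p-2)\lambda_{\max}(D^2\phi(x_0))\ge f(x_0)$ (respectively $\Delta\phi(x_0)+(p-2)\lambda_{\min}(D^2\phi(x_0))\le f(x_0)$); (3) if $\nabla\phi(x_0)=0$ and $1<p<2$, then $\Delta\phi(x_0)+(p-2)\lambda_{\min}(D^2\phi(x_0))\ge f(x_0)$ (respectively $\Delta\phi(x_0)+(p-2)\lambda_{\max}(D^2\phi(x_0))\le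 f(x_0)$). A viscosity solution is both a viscosity subsolution and a viscosity supersolution. *)

theory Defs
  imports "HOL-Analysis.Analysis" "HOL-Probability.Essential_Supremum"
begin

definition grad :: "(real^'n \<Rightarrow> real) \<Rightarrow> real^'n \<Rightarrow> real^'n" where
  "grad \<phi> x = (\<chi> i. frechet_derivative \<phi> (at x) (axis i 1))"

definition hessian :: "(real^'n \<Rightarrow> real) \<Rightarrow> real^'n \<Rightarrow> real^'n^'n" where
  "hessian \<phi> x = jacobian (grad \<phi>) (at x)"

(* Intended for open sets \<Omega>.  Continuity of \<phi> and of its gradient follows from differentiability. *)
definition C2_on :: "(real^'n) set \<Rightarrow> (real^'n \<Rightarrow> real) \<Rightarrow> bool" where
  "C2_on \<Omega> \<phi> \<longleftrightarrow>
     (\<forall>x\<in>\<Omega>. \<phi> differentiable (at x)) \<and>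
     (\<forall>x\<in>\<Omega>. grad \<phi> differentiable (at x)) \<and>
     continuous_on \<Omega> (hessian \<phi>)"

definition laplacian :: "(real^'n \<Rightarrow> real) \<Rightarrow> real^'n \<Rightarrow> real" where
  "laplacian \<phi> x = trace (hessian \<phi> x)"

definition eigenvalues :: "real^'n^'n \<Rightarrow> real set" where
  "eigenvalues X = {l. \<exists>v. v \<noteq> 0 \<and> X *v v = l *\<^sub>R v}"

(* Meaningful for symmetric X, whose set of real eigenvalues is finite and nonempty. *)
definition lambda_max :: "real^'n^'n \<Rightarrow> real" where
  "lambda_max X = Max (eigenvalues X)"

definition lambda_min :: "real^'n^'n \<Rightarrow> real" where
  "lambda_min X = Min (eigenvalues X)"

(* Meaningful only where the gradient is nonzero. *)
definition normalized_p_laplacian :: "real \<Rightarrow> (real^'n \<Rightarrow> real) \<Rightarrow> real^'n \<Rightarrow> real" where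
  "normalized_p_laplacian p \<phi> x =
     (let \<nu> = grad \<phi> x /\<^sub>R norm (grad \<phi> x)
      in laplacian \<phi> x + (p - 2) * ((hessian \<phi> x *v \<nu>) \<bullet> \<nu>))"

definition hamiltonian ::
  "real \<Rightarrow> real \<Rightarrow> (real^'n \<Rightarrow> real^'n) \<Rightarrow> (real^'n \<Rightarrow> real) \<Rightarrow> real^'n \<Rightarrow> real^'n \<Rightarrow> real" where
  "hamiltonian \<theta> \<sigma> B \<rho> \<xi> x = (B x \<bullet> \<xi>) * norm \<xi> powr \<theta> + \<rho> x * norm \<xi> powr \<sigma>"

(* For \<Omega> open, x \<in> \<Omega>. *)
definition local_max_in :: "(real^'n) set \<Rightarrow> (real^'n \<Rightarrow> real) \<Rightarrow> real^'n \<Rightarrow> bool" where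
  "local_max_in \<Omega> g x \<longleftrightarrow> (\<forall>\<^sub>F y in at x within \<Omega>. g y \<le> g x)"

definition local_min_in :: "(real^'n) set \<Rightarrow> (real^'n \<Rightarrow> real) \<Rightarrow> real^'n \<Rightarrow> bool" where
  "local_min_in \<Omega> g x \<longleftrightarrow> (\<forall>\<^sub>F y in at x within \<Omega>. g x \<le> g y)"

(* Sub- and supersolutions of |grad u|^\<theta> * normalized_p_laplacian p u + H (grad u) x = f x in \<Omega>.
   At points where the gradient of the test function vanishes, the required inequality
   carries no factor |grad \<phi>|^\<theta>. *)
definition viscosity_subsolution ::
  "real \<Rightarrow> real \<Rightarrow> (real^'n \<Rightarrow> real^'n \<Rightarrow> real) \<Rightarrow> (real^'n \<Rightarrow> real) \<Rightarrow> (real^'n) set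
    \<Rightarrow> (real^'n \<Rightarrow> real) \<Rightarrow> bool" where
  "viscosity_subsolution p \<theta> H f \<Omega> u \<longleftrightarrow>
     continuous_on \<Omega> u \<and>
     (\<forall>\<phi>. \<forall>x\<in>\<Omega>. C2_on \<Omega> \<phi> \<longrightarrow> local_max_in \<Omega> (\<lambda>y. u y - \<phi> y) x \<longrightarrow>
        (grad \<phi> x \<noteq> 0 \<longrightarrow>
           norm (grad \<phi> x) powr \<theta> * normalized_p_laplacian p \<phi> x + H (grad \<phi> x) x \<ge> f x) \<and>
        (grad \<phi> x = 0 \<and> p \<ge> 2 \<longrightarrow>
           laplacian \<phi> x + (p - 2) * lambda_max (hessian \<phi> x) \<ge> f x) \<and>
        (grad \<phi> x = 0 \<and> 1 < p \<and> p < 2 \<longrightarrow>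
           laplacian \<phi> x + (p - 2) * lambda_min (hessian \<phi> x) \<ge> f x))"

definition viscosity_supersolution ::
  "real \<Rightarrow> real \<Rightarrow> (real^'n \<Rightarrow> real^'n \<Rightarrow> real) \<Rightarrow> (real^'n \<Rightarrow> real) \<Rightarrow> (real^'n) set
    \<Rightarrow> (real^'n \<Rightarrow> real) \<Rightarrow> bool" where
  "viscosity_supersolution p \<theta> H f \<Omega> u \<longleftrightarrow>
     continuous_on \<Omega> u \<and>
     (\<forall>\<phi>. \<forall>x\<in>\<Omega>. C2_on \<Omega> \<phi> \<longrightarrow> local_min_in \<Omega> (\<lambda>y. u y - \<phi> y) x \<longrightarrow>
        (grad \<phi> x \<noteq> 0 \<longrightarrow>
           norm (grad \<phi> x) powr \<theta> * normalized_p_laplacian p \<phi> x + H (grad \<phi> x) x \<le> f x) \<and>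
        (grad \<phi> x = 0 \<and> p \<ge> 2 \<longrightarrow>
           laplacian \<phi> x + (p - 2) * lambda_min (hessian \<phi> x) \<le> f x) \<and>
        (grad \<phi> x = 0 \<and> 1 < p \<and> p < 2 \<longrightarrow>
           laplacian \<phi> x + (p - 2) * lambda_max (hessian \<phi> x) \<le> f x))"

definition viscosity_solution ::
  "real \<Rightarrow> real \<Rightarrow> (real^'n \<Rightarrow> real^'n \<Rightarrow> real) \<Rightarrow> (real^'n \<Rightarrow> real) \<Rightarrow> (real^'n) set
    \<Rightarrow> (real^'n \<Rightarrow> real) \<Rightarrow> bool" where
  "viscosity_solution p \<theta> H f \<Omega> u \<longleftrightarrow>
     viscosity_subsolution p \<theta> H f \<Omega> u \<and> viscosity_supersolution p \<theta> H f \<Omega> u"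

definition Linf_norm :: "(real^'n) set \<Rightarrow> (real^'n \<Rightarrow> 'b::euclidean_space) \<Rightarrow> ereal" where
  "Linf_norm \<Omega> g = esssup (lebesgue_on \<Omega>) (\<lambda>x. ereal (norm (g x)))"

definition in_Linf :: "(real^'n) set \<Rightarrow> (real^'n \<Rightarrow> 'b::euclidean_space) \<Rightarrow> bool" where
  "in_Linf \<Omega> g \<longleftrightarrow> g \<in> borel_measurable (lebesgue_on \<Omega>) \<and> Linf_norm \<Omega> g < \<infinity>"

end

theory Submission
  imports Defs
begin

text \<open>
  The lower bound is proved around an arbitrary point \<open>x0\<close> of the unit ball. Write
  \<open>\<alpha> = 1 + 1/(1+\<theta>)\<close>, so that \<open>(\<alpha> - 1)(1 + \<theta>) = 1\<close>, and let \<open>\<Phi>\<^sub>z(x) = C |x - z|\<^sup>\<alpha>\<close>. For small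
  \<open>C\<close> the operator applied to \<open>\<Phi>\<^sub>z\<close> is below \<open>c0\<close> away from \<open>z\<close>, so \<open>u - \<Phi>\<^sub>z\<close> has no local
  maximum other than possibly \<open>z\<close>. The function \<open>\<Phi>\<^sub>z\<close> is never differentiated: since
  \<open>t \<mapsto> t powr (\<alpha> / 2)\<close> is concave, \<open>\<Phi>\<^sub>z\<close> lies below a paraboloid centred at \<open>z\<close>, shifted by a
  constant, that touches it along any prescribed sphere about \<open>z\<close>, and the paraboloid is the test function
  (lemmas \<open>powr_le_tangent_paraboloid\<close> and \<open>subsolution_no_local_max_minus_power\<close>).

  Suppose that the supremum of \<open>u - u(x0)\<close> over the sphere of radius \<open>r\<close> about \<open>x0\<close> is less than
  \<open>C r\<^sup>\<alpha>\<close>. For every \<open>z\<close> close to \<open>x0\<close> the maximum of \<open>u - \<Phi>\<^sub>z\<close> over the closed ball is then interior, hence attained at \<open>z\<close>, that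
  is \<open>u(x) - u(z) \<le> C |x - z|\<^sup>\<alpha>\<close>. Letting both \<open>x\<close> and \<open>z\<close> vary near \<open>x0\<close> and using \<open>\<alpha> > 1\<close>, one
  finds that \<open>u\<close> is constant near \<open>x0\<close> (lemma \<open>locally_constant_of_power_bound\<close>). This is impossible,
  because testing with a constant would give \<open>f(x0) \<le> 0\<close> (lemma \<open>subsolution_no_local_max\<close>).
\<close>

section \<open>Paraboloids as test functions\<close>

text \<open>The paraboloid with vertex \<open>z\<close> and Hessian \<open>a\<close> times the identity. The value \<open>a = 0\<close> is
  allowed and gives the zero function.\<close>

definition paraboloid :: "real \<Rightarrow> real^'n \<Rightarrow> real^'n \<Rightarrow> real" where
  "paraboloid a z x = a / 2 * (norm (x - z))\<^sup>2"

lemma has_derivative_paraboloid: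
  "(paraboloid a z has_derivative (\<lambda>h. a * ((x - z) \<bullet> h))) (at x)"
proof -
  have eq: "paraboloid a z = (\<lambda>y. a / 2 * ((y - z) \<bullet> (y - z)))"
    by (simp add: fun_eq_iff paraboloid_def power2_norm_eq_inner)
  show ?thesis
    unfolding eq by (auto intro!: derivative_eq_intros simp: inner_commute algebra_simps)
qed

lemma grad_paraboloid: "grad (paraboloid a z) = (\<lambda>x. a *\<^sub>R (x - z))"
proof
  fix x
  have "frechet_derivative (paraboloid a z) (at x) = (\<lambda>h. a * ((x - z) \<bullet> h))"
    using frechet_derivative_at[OF has_derivative_paraboloid] by metis
  then show "grad (paraboloid a z) x = a *\<^sub>R (x - z)"
    by (simp add: grad_def vec_eq_iff inner_axis)
qed

lemma has_derivative_grad_paraboloid: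
  "(grad (paraboloid a z) has_derivative (*\<^sub>R) a) (at x)"
  unfolding grad_paraboloid by (auto intro!: derivative_eq_intros)

lemma hessian_paraboloid: "hessian (paraboloid a z) x = mat a"
  using frechet_derivative_at[OF has_derivative_grad_paraboloid[of a z x]]
  by (simp add: hessian_def jacobian_def flip: matrix_scaleR)

lemma C2_on_paraboloid: "C2_on S (paraboloid a z)"
  unfolding C2_on_def differentiable_def hessian_paraboloid
  using has_derivative_paraboloid has_derivative_grad_paraboloid
  by (blast intro: continuous_on_const)

lemma laplacian_paraboloid:
  fixes z :: "real^'n"
  shows "laplacian (paraboloid a z) x = real CARD('n) * a"
  by (simp add: laplacian_def hessian_paraboloid trace_def mat_def)

lemma mat_mult_vec: "mat a *v v = a *\<^sub>R (v :: real^'n)"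
  by (simp add: matrix_scaleR[symmetric] matrix_works linear_iff scaleR_right_distrib)

lemma normalized_p_laplacian_paraboloid:
  fixes z :: "real^'n"
  assumes "a \<noteq> 0" "x \<noteq> z"
  shows "normalized_p_laplacian p (paraboloid a z) x = (real CARD('n) + p - 2) * a"
proof -
  define \<nu> where "\<nu> = grad (paraboloid a z) x /\<^sub>R norm (grad (paraboloid a z) x)"
  have "norm \<nu> = 1"
    using assms by (simp add: \<nu>_def grad_paraboloid flip: divide_inverse_commute)
  then have "\<nu> \<bullet> \<nu> = 1"
    by (simp add: dot_square_norm)
  then show ?thesis
    by (simp add: normalized_p_laplacian_def Let_def laplacian_paraboloid hessian_paraboloid
        mat_mult_vec flip: \<nu>_def) (simp add: algebra_simps)
qed

lemma eigenvalues_zero: "eigenvalues (0 :: real^'n^'n) = {0}"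
proof -
  have "axis undefined 1 \<noteq> (0 :: real^'n)"
    by (simp add: axis_eq_0_iff)
  then show ?thesis
    by (auto simp: eigenvalues_def)
qed

section \<open>Subsolutions with positive right-hand side\<close>

text \<open>Only the clauses for a vanishing gradient enter: the test function is constant.\<close>

lemma subsolution_no_local_max:
  assumes sub: "viscosity_subsolution p \<theta> H f S u" and "1 < p" "x \<in> S" "0 < f x"
  shows "\<not> local_max_in S u x"
proof
  assume max: "local_max_in S u x"
  have "local_max_in S (\<lambda>y. u y - paraboloid 0 0 y) x"
    using max by (simp add: local_max_in_def paraboloid_def)
  moreover have "grad (paraboloid 0 0) x = 0"
    by (simp add: grad_paraboloid)
  ultimately have
    "p \<ge> 2 \<Longrightarrow> f x \<le> laplacian (paraboloid 0 0) x + (p - 2) * lambda_max (hessian (paraboloid 0 0) x)"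
    "p < 2 \<Longrightarrow> f x \<le> laplacian (paraboloid 0 0) x + (p - 2) * lambda_min (hessian (paraboloid 0 0) x)"
    using sub \<open>x \<in> S\<close> \<open>1 < p\<close> C2_on_paraboloid[of S 0 0]
    unfolding viscosity_subsolution_def by blast+
  then have "p \<ge> 2 \<Longrightarrow> f x \<le> 0" "p < 2 \<Longrightarrow> f x \<le> 0"
    by (simp_all add: laplacian_paraboloid hessian_paraboloid eigenvalues_zero
        lambda_max_def lambda_min_def)
  then show False
    using \<open>0 < f x\<close> by linarith
qed

text \<open>The concavity of \<open>t \<mapsto> t powr (\<alpha> / 2)\<close>, read off from Young's inequality for \<open>t\<^sup>2\<close> and \<open>s\<^sup>2\<close>.\<close>

lemma powr_le_tangent_paraboloid:
  fixes s t \<alpha> :: real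
  assumes "0 < s" "0 \<le> t" "0 < \<alpha>" "\<alpha> < 2"
  shows "t powr \<alpha> \<le> s powr \<alpha> + \<alpha> / 2 * s powr (\<alpha> - 2) * (t\<^sup>2 - s\<^sup>2)"
proof -
  have s2: "s powr (\<alpha> - 2) * s\<^sup>2 = s powr \<alpha>"
    using assms by (simp add: powr_diff)
  show ?thesis
  proof (cases "t = 0")
    case True
    have "\<alpha> / 2 * s powr \<alpha> \<le> 1 * s powr \<alpha>"
      using assms by (intro mult_right_mono) auto
    then show ?thesis
      using True s2 by (simp add: mult.assoc)
  next
    case False
    then have "0 < t"
      using assms by simp
    have "(t\<^sup>2) powr (\<alpha> / 2) * (s\<^sup>2) powr (1 - \<alpha> / 2) \<le> \<alpha> / 2 * t\<^sup>2 + (1 - \<alpha> / 2) * s\<^sup>2"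
      using assms \<open>0 < t\<close> by (intro Youngs_inequality_0) auto
    moreover have "(t\<^sup>2) powr (\<alpha> / 2) = t powr \<alpha>"
      using \<open>0 < t\<close> by (simp add: powr_powr flip: powr_numeral)
    moreover have "(s\<^sup>2) powr (1 - \<alpha> / 2) = s powr (2 - \<alpha>)"
      using assms by (simp add: powr_powr right_diff_distrib flip: powr_numeral)
    ultimately have "s powr (\<alpha> - 2) * (t powr \<alpha> * s powr (2 - \<alpha>))
        \<le> s powr (\<alpha> - 2) * (\<alpha> / 2 * t\<^sup>2 + (1 - \<alpha> / 2) * s\<^sup>2)"
      by (intro mult_left_mono) auto
    moreover have "s powr (\<alpha> - 2) * (t powr \<alpha> * s powr (2 - \<alpha>)) = t powr \<alpha>"
    proof -
      have "s powr (\<alpha> - 2) * s powr (2 - \<alpha>) = 1"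
        using assms by (simp flip: powr_add)
      then show ?thesis
        by (simp add: mult.left_commute)
    qed
    moreover have "s powr (\<alpha> - 2) * (\<alpha> / 2 * t\<^sup>2 + (1 - \<alpha> / 2) * s\<^sup>2)
        = s powr (\<alpha> - 2) * s\<^sup>2 + \<alpha> / 2 * s powr (\<alpha> - 2) * (t\<^sup>2 - s\<^sup>2)"
      by algebra
    ultimately show ?thesis
      using s2 by simp
  qed
qed

text \<open>The number \<open>D\<close> stands for \<open>C\<alpha>\<close>. Since \<open>D \<le> 1\<close> and \<open>\<sigma> < 1 + \<theta>\<close>, all three terms of the
  operator are bounded by a multiple of \<open>D\<^sup>\<sigma>\<close>. The factors 2 come from \<open>|y - z| \<le> 2\<close>.\<close>

lemma subsolution_no_local_max_minus_power:
  fixes u :: "real^'n \<Rightarrow> real" and y z :: "real^'n" and \<theta> :: real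
  defines "\<alpha> \<equiv> 1 + 1 / (1 + \<theta>)"
  assumes p: "1 < p" and \<theta>: "0 < \<theta>" and \<sigma>: "\<theta> < \<sigma>" "\<sigma> < 1 + \<theta>"
    and sub: "viscosity_subsolution p \<theta> (hamiltonian \<theta> \<sigma> B \<rho>) f S u"
    and y: "y \<in> S" "y \<noteq> z" "norm (y - z) \<le> 2"
    and B: "norm (B y) \<le> NB" and \<rho>: "\<bar>\<rho> y\<bar> \<le> N\<rho>"
    and D: "0 < D" "D \<le> 1"
    and small: "D powr \<sigma> * (real CARD('n) + p - 2 + 2 * NB + 2 * N\<rho>) < f y"
  shows "\<not> local_max_in S (\<lambda>x. u x - D / \<alpha> * norm (x - z) powr \<alpha>) y"
proof
  assume max: "local_max_in S (\<lambda>x. u x - D / \<alpha> * norm (x - z) powr \<alpha>) y"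
  have \<alpha>: "1 < \<alpha>" "\<alpha> < 2" and \<alpha>\<theta>: "(\<alpha> - 1) * (1 + \<theta>) = 1"
    using \<theta> by (auto simp: \<alpha>_def field_simps)
  define s where "s = norm (y - z)"
  have s: "0 < s" "s \<le> 2"
    using y by (auto simp: s_def)
  \<comment> \<open>With this curvature the paraboloid touches the power function to first order on \<open>|x - z| = s\<close>.\<close>
  define a where "a = D * s powr (\<alpha> - 2)"
  have a: "0 < a"
    using D s by (simp add: a_def)
  define g where "g = a * s"
  have g: "g = D * s powr (\<alpha> - 1)"
    using s powr_add[of s "\<alpha> - 2" 1] by (simp add: g_def a_def)
  have above: "D / \<alpha> * norm (x - z) powr \<alpha> - D / \<alpha> * s powr \<alpha>
      \<le> paraboloid a z x - paraboloid a z y" for x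
  proof -
    have "D / \<alpha> * norm (x - z) powr \<alpha>
      \<le> D / \<alpha> * (s powr \<alpha> + \<alpha> / 2 * s powr (\<alpha> - 2) * ((norm (x - z))\<^sup>2 - s\<^sup>2))"
      using D s \<alpha> by (intro mult_left_mono powr_le_tangent_paraboloid) auto
    also have "\<dots> = D / \<alpha> * s powr \<alpha> + (paraboloid a z x - paraboloid a z y)"
      using \<alpha> by (simp add: paraboloid_def a_def s_def[symmetric] field_simps)
    finally show ?thesis by simp
  qed
  have "local_max_in S (\<lambda>x. u x - paraboloid a z x) y"
    using max unfolding local_max_in_def
  proof (rule eventually_mono)
    fix x
    assume "u x - D / \<alpha> * norm (x - z) powr \<alpha> \<le> u y - D / \<alpha> * norm (y - z) powr \<alpha>"
    then show "u x - paraboloid a z x \<le> u y - paraboloid a z y"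
      using above[of x] by (simp add: s_def)
  qed
  moreover have grad: "grad (paraboloid a z) y \<noteq> 0" "norm (grad (paraboloid a z) y) = g"
    using a y by (simp_all add: grad_paraboloid g_def s_def)
  ultimately have "f y \<le> g powr \<theta> * normalized_p_laplacian p (paraboloid a z) y
      + hamiltonian \<theta> \<sigma> B \<rho> (grad (paraboloid a z) y) y"
    using sub y C2_on_paraboloid[of S a z] unfolding viscosity_subsolution_def by metis
  also have "normalized_p_laplacian p (paraboloid a z) y = (real CARD('n) + p - 2) * a"
    using a y by (simp add: normalized_p_laplacian_paraboloid)
  also have "hamiltonian \<theta> \<sigma> B \<rho> (grad (paraboloid a z) y) y
      = (B y \<bullet> grad (paraboloid a z) y) * g powr \<theta> + \<rho> y * g powr \<sigma>"
    by (simp add: hamiltonian_def grad)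
  also have "B y \<bullet> grad (paraboloid a z) y \<le> NB * g"
    using B grad(2) Cauchy_Schwarz_ineq2[of "B y" "grad (paraboloid a z) y"]
    by (smt (verit) mult_right_mono norm_ge_zero)
  also have "\<rho> y \<le> N\<rho>"
    using \<rho> by simp
  finally have bound: "f y \<le> (real CARD('n) + p - 2) * (g powr \<theta> * a)
      + NB * (g powr \<theta> * g) + N\<rho> * g powr \<sigma>"
    by (simp add: mult_right_mono algebra_simps)
  have D\<theta>: "D powr (1 + \<theta>) \<le> D powr \<sigma>"
    using D \<sigma> by (intro powr_mono') auto
  \<comment> \<open>The choice of \<open>\<alpha>\<close> makes the second-order term independent of \<open>s\<close>.\<close>
  have g\<theta>: "g powr \<theta> * g = D powr (1 + \<theta>) * s"
  proof -
    have "g powr \<theta> * g = g powr (1 + \<theta>)"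
      using a s by (simp add: powr_add g_def)
    also have "\<dots> = D powr (1 + \<theta>) * s powr ((\<alpha> - 1) * (1 + \<theta>))"
      using D by (simp add: g powr_mult powr_powr)
    finally show ?thesis
      using s by (simp add: \<alpha>\<theta>)
  qed
  have ga: "g powr \<theta> * a = D powr (1 + \<theta>)"
    using g\<theta> s by (simp add: g_def)
  have g\<sigma>: "g powr \<sigma> \<le> D powr \<sigma> * 2"
  proof -
    have exp: "0 \<le> (\<alpha> - 1) * \<sigma>" "(\<alpha> - 1) * \<sigma> \<le> 1"
      using \<alpha> \<sigma> \<theta> by (auto simp: \<alpha>_def field_simps)
    have "s powr ((\<alpha> - 1) * \<sigma>) \<le> 2 powr ((\<alpha> - 1) * \<sigma>)"
      using s exp by (intro powr_mono2) auto
    also have "\<dots> \<le> 2 powr 1"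
      using exp by (intro powr_mono) auto
    finally show ?thesis
      using D by (simp add: g powr_mult powr_powr mult_left_mono)
  qed
  have NB: "0 \<le> NB"
    using B norm_ge_zero order_trans by blast
  have N\<rho>: "0 \<le> N\<rho>"
    using \<rho> by simp
  have n: "0 \<le> real CARD('n) + p - 2"
    using p zero_less_card_finite[where 'a='n] by linarith
  have "(real CARD('n) + p - 2) * (g powr \<theta> * a) \<le> (real CARD('n) + p - 2) * D powr \<sigma>"
    using D\<theta> n ga by (simp add: mult_left_mono)
  moreover have "NB * (g powr \<theta> * g) \<le> NB * (D powr \<sigma> * 2)"
    unfolding g\<theta> using D\<theta> s NB by (intro mult_left_mono mult_mono) auto
  moreover have "N\<rho> * g powr \<sigma> \<le> N\<rho> * (D powr \<sigma> * 2)"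
    using g\<sigma> N\<rho> by (intro mult_left_mono) auto
  ultimately have "f y \<le> D powr \<sigma> * (real CARD('n) + p - 2 + 2 * NB + 2 * N\<rho>)"
    using bound by (simp add: algebra_simps)
  then show False
    using small by simp
qed

section \<open>The growth estimate\<close>

text \<open>A one-sided bound for all pairs of points is a two-sided one, so the derivative vanishes.\<close>

lemma locally_constant_of_power_bound:
  fixes u :: "'a::real_normed_vector \<Rightarrow> real"
  assumes S: "open S" "convex S" and "1 < \<alpha>"
    and bound: "\<And>x z. x \<in> S \<Longrightarrow> z \<in> S \<Longrightarrow> u x - u z \<le> C * norm (x - z) powr \<alpha>"
    and "x \<in> S" "y \<in> S"
  shows "u x = u y"
proof (rule has_derivative_zero_unique[OF S(2) _ \<open>x \<in> S\<close> \<open>y \<in> S\<close>])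
  fix z assume z: "z \<in> S"
  have "((\<lambda>x. C * norm (x - z) powr (\<alpha> - 1)) \<longlongrightarrow> C * 0 powr (\<alpha> - 1)) (at z)"
    using \<open>1 < \<alpha>\<close> by (intro tendsto_intros tendsto_norm_zero tendsto_powr') (auto intro!: LIM_zero)
  then have lim: "((\<lambda>x. C * norm (x - z) powr (\<alpha> - 1)) \<longlongrightarrow> 0) (at z)"
    by simp
  have "((\<lambda>x. (u x - u z) /\<^sub>R norm (x - z)) \<longlongrightarrow> 0) (at z)"
  proof (rule Lim_null_comparison[OF _ lim])
    have "\<forall>\<^sub>F x in at z. x \<in> S \<and> x \<noteq> z"
      using S z by (auto simp: eventually_at_topological)
    then show "\<forall>\<^sub>F x in at z. norm ((u x - u z) /\<^sub>R norm (x - z)) \<le> C * norm (x - z) powr (\<alpha> - 1)"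
    proof (rule eventually_mono)
      fix x assume x: "x \<in> S \<and> x \<noteq> z"
      then have "\<bar>u x - u z\<bar> \<le> C * norm (x - z) powr \<alpha>"
        using bound[of x z] bound[of z x] z by (simp add: norm_minus_commute abs_le_iff)
      then show "norm ((u x - u z) /\<^sub>R norm (x - z)) \<le> C * norm (x - z) powr (\<alpha> - 1)"
        using x by (simp add: powr_diff divide_simps)
    qed
  qed
  then have "(u has_derivative (\<lambda>h. 0)) (at z)"
    by (simp add: has_derivative_at_within)
  then show "(u has_derivative (\<lambda>h. 0)) (at z within S)"
    by (rule has_derivative_at_withinI)
qed

text \<open>The comparison step, detached from the equation: if no \<open>u - C |x - z|\<^sup>\<alpha>\<close> has its maximum over
  the ball at an interior point other than \<open>z\<close>, then a small supremum over the sphere makes \<open>u\<close>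
  constant near the centre.\<close>

lemma sphere_growth:
  fixes u :: "'a::euclidean_space \<Rightarrow> real"
  assumes S: "cball x0 r \<subseteq> S" and u: "continuous_on S u" and r: "0 < r"
    and \<alpha>: "1 < \<alpha>" and C: "0 \<le> C"
    and nomax: "\<And>y z. y \<in> ball x0 r \<Longrightarrow> z \<in> ball x0 r \<Longrightarrow> y \<noteq> z \<Longrightarrow>
      \<exists>x\<in>ball x0 r. u y - C * norm (y - z) powr \<alpha> < u x - C * norm (x - z) powr \<alpha>"
    and nonconst: "\<And>\<delta>. 0 < \<delta> \<Longrightarrow> \<exists>x\<in>ball x0 \<delta>. u x \<noteq> u x0"
  shows "C * r powr \<alpha> \<le> (SUP x\<in>sphere x0 r. u x - u x0)"
proof (rule ccontr)
  assume neg: "\<not> ?thesis"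
  define m where "m = (SUP x\<in>sphere x0 r. u x - u x0)"
  have ucb: "continuous_on (cball x0 r) u"
    using u S continuous_on_subset by blast
  have "continuous_on (sphere x0 r) (\<lambda>x. u x - u x0)"
    by (intro continuous_intros continuous_on_subset[OF ucb]) auto
  then have "bdd_above ((\<lambda>x. u x - u x0) ` sphere x0 r)"
    using compact_continuous_image compact_sphere bounded_imp_bdd_above compact_imp_bounded by metis
  then have m: "u x - u x0 \<le> m" if "x \<in> sphere x0 r" for x
    unfolding m_def using that by (rule cSUP_upper2) auto
  have contx0: "isCont u x0"
    using ucb r by (meson ball_subset_cball centre_in_ball continuous_on_interior interior_cball
        continuous_on_subset continuous_on_eq_continuous_at open_ball)
  have "isCont (\<lambda>z. u z - u x0 - m + C * (r - norm (z - x0)) powr \<alpha>) x0"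
    using r by (intro continuous_intros contx0) auto
  then have "((\<lambda>z. u z - u x0 - m + C * (r - norm (z - x0)) powr \<alpha>)
      \<longlongrightarrow> - m + C * r powr \<alpha>) (at x0)"
    by (simp add: isCont_def)
  moreover have "0 < - m + C * r powr \<alpha>"
    using neg by (simp add: m_def)
  ultimately have "\<forall>\<^sub>F z in at x0. 0 < u z - u x0 - m + C * (r - norm (z - x0)) powr \<alpha>"
    by (rule order_tendstoD(1))
  then obtain \<delta>0 where \<delta>0: "\<delta>0 > 0" and pos0: "\<And>z. z \<noteq> x0 \<Longrightarrow> dist z x0 < \<delta>0 \<Longrightarrow>
      0 < u z - u x0 - m + C * (r - norm (z - x0)) powr \<alpha>"
    unfolding eventually_at by auto
  have pos: "0 < u z - u x0 - m + C * (r - norm (z - x0)) powr \<alpha>" if "dist z x0 < \<delta>0" for z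
    using pos0[OF _ that] \<open>0 < - m + C * r powr \<alpha>\<close> by (cases "z = x0") auto
  define \<delta> where "\<delta> = min \<delta>0 r"
  have \<delta>: "0 < \<delta>" "\<delta> \<le> \<delta>0" "\<delta> \<le> r"
    using \<delta>0 r by (auto simp: \<delta>_def)
  \<comment> \<open>By \<open>pos\<close>, the maximum is not attained on the sphere.\<close>
  have maxz: "u x - u z \<le> C * norm (x - z) powr \<alpha>"
    if z: "z \<in> ball x0 \<delta>" and x: "x \<in> cball x0 r" for x z
  proof -
    define v where "v = (\<lambda>x. u x - C * norm (x - z) powr \<alpha>)"
    have "continuous_on (cball x0 r) v"
      unfolding v_def using \<alpha> by (intro continuous_intros ucb continuous_on_powr') auto
    then obtain y where y: "y \<in> cball x0 r" and ymax: "\<And>x. x \<in> cball x0 r \<Longrightarrow> v x \<le> v y"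
      using continuous_attains_sup[of "cball x0 r" v] r by (auto simp: cball_eq_empty)
    have zr: "z \<in> ball x0 r"
      using z \<delta> by auto
    have vz: "v z = u z"
      by (simp add: v_def)
    have "y \<notin> sphere x0 r"
    proof
      assume ys: "y \<in> sphere x0 r"
      have "r - norm (z - x0) \<le> norm (y - z)"
        using ys norm_triangle_ineq[of "x0 - z" "z - y"]
        by (simp add: dist_norm norm_minus_commute)
      moreover have "0 \<le> r - norm (z - x0)"
        using zr by (simp add: dist_norm norm_minus_commute)
      ultimately have "C * (r - norm (z - x0)) powr \<alpha> \<le> C * norm (y - z) powr \<alpha>"
        using C \<alpha> by (intro mult_left_mono powr_mono2) auto
      then have "v y < u z"
        using m[OF ys] pos[of z] z \<delta> by (simp add: v_def dist_commute)
      then show False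
        using ymax[of z] zr vz by auto
    qed
    then have yb: "y \<in> ball x0 r"
      using y by auto
    have "y = z"
    proof (rule ccontr)
      assume "y \<noteq> z"
      then obtain x where "x \<in> ball x0 r" "v y < v x"
        using nomax[OF yb zr] by (auto simp: v_def)
      then show False
        using ymax[of x] by auto
    qed
    then show ?thesis
      using ymax[OF x] vz by (simp add: v_def)
  qed
  have "u x = u x0" if "x \<in> ball x0 \<delta>" for x
  proof (rule locally_constant_of_power_bound[OF open_ball convex_ball \<alpha> _ that])
    show "x0 \<in> ball x0 \<delta>"
      using \<delta> by simp
    show "u x - u z \<le> C * norm (x - z) powr \<alpha>" if "x \<in> ball x0 \<delta>" "z \<in> ball x0 \<delta>" for x z
      using that \<delta> by (intro maxz) auto
  qed
  then show False
    using nonconst[OF \<delta>(1)] by blast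
qed

text \<open>For a continuous function a finite essential supremum over an open set is a pointwise bound.\<close>

lemma norm_le_Linf_norm:
  fixes g :: "real^'n \<Rightarrow> 'b::euclidean_space"
  assumes S: "open S" and g: "continuous_on S g" and N: "Linf_norm S g = ereal N" and x: "x \<in> S"
  shows "norm (g x) \<le> N"
proof (rule ccontr)
  assume "\<not> norm (g x) \<le> N"
  define U where "U = {y \<in> S. N < norm (g y)}"
  have "open (S \<inter> (\<lambda>y. norm (g y)) -` {N<..})"
    by (intro continuous_open_preimage continuous_intros g S open_greaterThan)
  also have "S \<inter> (\<lambda>y. norm (g y)) -` {N<..} = U"
    by (auto simp: U_def)
  finally have "open U" .
  have "AE y in lebesgue_on S. ereal (norm (g y)) \<le> ereal N"
    using esssup_AE[of "\<lambda>y. ereal (norm (g y))" "lebesgue_on S"] N by (simp add: Linf_norm_def)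
  then have "AE y in lebesgue. y \<in> S \<longrightarrow> norm (g y) \<le> N"
    using S by (simp add: AE_restrict_space_iff)
  then have "AE y\<in>U in lebesgue. y \<in> {}"
    by (rule eventually_mono) (auto simp: U_def)
  then show False
    using mem_closed_if_AE_lebesgue_open[OF \<open>open U\<close> closed_empty, of x] x \<open>\<not> norm (g x) \<le> N\<close>
    by (auto simp: U_def)
qed

theorem theorem1p8:
  fixes p \<theta> \<sigma> NB N\<rho> c0 :: real
  assumes "1 < p" and "0 < \<theta>" and "\<theta> < \<sigma>" and "\<sigma> < 1 + \<theta>" and "0 < c0"
  shows "\<exists>C>0. \<forall>(B :: real^'n \<Rightarrow> real^'n) (\<rho> :: real^'n \<Rightarrow> real) (f :: real^'n \<Rightarrow> real) (u :: real^'n \<Rightarrow> real).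
      continuous_on (cball 0 1) B \<longrightarrow>
      continuous_on (cball 0 1) \<rho> \<longrightarrow>
      Linf_norm (ball 0 1) B = ereal NB \<longrightarrow>
      Linf_norm (ball 0 1) \<rho> = ereal N\<rho> \<longrightarrow>
      in_Linf (ball 0 1) f \<longrightarrow>
      continuous_on (ball 0 1) f \<longrightarrow>
      continuous_on (ball 0 1) u \<longrightarrow>
      bounded (u ` ball 0 1) \<longrightarrow>
      viscosity_solution p \<theta> (hamiltonian \<theta> \<sigma> B \<rho>) f (ball 0 1) u \<longrightarrow>
      ereal c0 \<le> (INF x\<in>ball 0 1. ereal (f x)) \<longrightarrow>
      (\<forall>x0\<in>ball 0 1. local_max_in (ball 0 1) u x0 \<or> local_min_in (ball 0 1) u x0 \<longrightarrow>
         (\<forall>r>0. cball x0 r \<subseteq> ball 0 1 \<longrightarrow>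
            C * r powr (1 + 1 / (1 + \<theta>)) \<le> (SUP x\<in>sphere x0 r. u x - u x0)))"
proof -
  define \<alpha> where "\<alpha> = 1 + 1 / (1 + \<theta>)"
  \<comment> \<open>The absolute values make \<open>M > 0\<close> evident; \<open>D\<close> is chosen to give \<open>D powr \<sigma> * M \<le> c0 / 2\<close>.\<close>
  define M where "M = real CARD('n) + p - 2 + 2 * \<bar>NB\<bar> + 2 * \<bar>N\<rho>\<bar>"
  have M: "0 < M"
    using assms zero_less_card_finite[where 'a='n] unfolding M_def by linarith
  define D where "D = min 1 ((c0 / (2 * M)) powr (1 / \<sigma>))"
  have D: "0 < D" "D \<le> 1"
    using M assms by (auto simp: D_def)
  have "D powr \<sigma> \<le> ((c0 / (2 * M)) powr (1 / \<sigma>)) powr \<sigma>"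
    using D assms by (intro powr_mono2) (auto simp: D_def)
  also have "\<dots> = c0 / (2 * M)"
    using assms M by (simp add: powr_powr)
  finally have "D powr \<sigma> * M \<le> c0 / (2 * M) * M"
    using M by (intro mult_right_mono) auto
  also have "\<dots> < c0"
    using M assms by simp
  finally have small: "D powr \<sigma> * M < c0" .
  have \<alpha>: "1 < \<alpha>"
    using assms by (simp add: \<alpha>_def)
  show ?thesis
  proof (intro exI[of _ "D / \<alpha>"] conjI allI impI ballI)
    show "0 < D / \<alpha>"
      using D \<alpha> by simp
  next
    fix B :: "real^'n \<Rightarrow> real^'n" and \<rho> f u :: "real^'n \<Rightarrow> real" and x0 :: "real^'n" and r :: real
    assume B: "continuous_on (cball 0 1) B" and \<rho>: "continuous_on (cball 0 1) \<rho>"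
      and NB: "Linf_norm (ball 0 1) B = ereal NB" and N\<rho>: "Linf_norm (ball 0 1) \<rho> = ereal N\<rho>"
      and u: "continuous_on (ball 0 1) u"
      and sol: "viscosity_solution p \<theta> (hamiltonian \<theta> \<sigma> B \<rho>) f (ball 0 1) u"
      and c0: "ereal c0 \<le> (INF x\<in>ball 0 1. ereal (f x))"
      and x0: "x0 \<in> ball 0 1" and r: "0 < r" and sub: "cball x0 r \<subseteq> ball 0 1"
    have bB: "norm (B y) \<le> \<bar>NB\<bar>" if "y \<in> ball 0 1" for y
      using norm_le_Linf_norm[OF open_ball continuous_on_subset[OF B] NB that] by auto
    have b\<rho>: "\<bar>\<rho> y\<bar> \<le> \<bar>N\<rho>\<bar>" if "y \<in> ball 0 1" for y
      using norm_le_Linf_norm[OF open_ball continuous_on_subset[OF \<rho>] N\<rho> that] by auto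
    have f: "c0 \<le> f y" if "y \<in> ball 0 1" for y
      using c0 that by (simp add: le_INF_iff)
    have subsol: "viscosity_subsolution p \<theta> (hamiltonian \<theta> \<sigma> B \<rho>) f (ball 0 1) u"
      using sol by (simp add: viscosity_solution_def)
    have max: "local_max_in (ball 0 1) v y"
      if "y \<in> T" "open T" "\<And>x. x \<in> T \<Longrightarrow> v x \<le> v y" for v T y
      unfolding local_max_in_def eventually_at_topological using that by blast
    have nomax: "\<exists>x\<in>ball x0 r. u y - D / \<alpha> * norm (y - z) powr \<alpha>
        < u x - D / \<alpha> * norm (x - z) powr \<alpha>"
      if y: "y \<in> ball x0 r" and z: "z \<in> ball x0 r" and "y \<noteq> z" for y z
    proof -
      have y1: "y \<in> ball 0 1" and z1: "z \<in> ball 0 1"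
        using y z sub ball_subset_cball by blast+
      have "norm (y - z) \<le> 2"
        using y1 z1 norm_triangle_ineq4[of y z] by simp
      then have "\<not> local_max_in (ball 0 1) (\<lambda>x. u x - D / \<alpha> * norm (x - z) powr \<alpha>) y"
        unfolding \<alpha>_def using assms subsol y1 \<open>y \<noteq> z\<close> bB[OF y1] b\<rho>[OF y1] D small f[OF y1]
        by (intro subsolution_no_local_max_minus_power
            [where f = f and B = B and \<rho> = \<rho> and NB = "\<bar>NB\<bar>" and N\<rho> = "\<bar>N\<rho>\<bar>"])
          (auto simp: M_def)
      then have "\<not> (\<forall>x\<in>ball x0 r.
          u x - D / \<alpha> * norm (x - z) powr \<alpha> \<le> u y - D / \<alpha> * norm (y - z) powr \<alpha>)"
        using max[OF y open_ball, of "\<lambda>x. u x - D / \<alpha> * norm (x - z) powr \<alpha>"] by blast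
      then show ?thesis
        by (simp only: ball_simps(10) not_le)
    qed
    have nonconst: "\<exists>x\<in>ball x0 \<delta>. u x \<noteq> u x0" if "0 < \<delta>" for \<delta>
    proof (rule ccontr)
      assume "\<not> ?thesis"
      then have "u x \<le> u x0" if "x \<in> ball x0 \<delta>" for x
        using that by (metis order_refl)
      then have "local_max_in (ball 0 1) u x0"
        using \<open>0 < \<delta>\<close> by (intro max[of x0 "ball x0 \<delta>"]) simp_all
      moreover have "0 < f x0"
        using f[OF x0] \<open>0 < c0\<close> by linarith
      ultimately show False
        using subsolution_no_local_max[OF subsol \<open>1 < p\<close> x0] by blast
    qed
    have "0 \<le> D / \<alpha>"
      using D \<alpha> by simp
    then have "D / \<alpha> * r powr \<alpha> \<le> (SUP x\<in>sphere x0 r. u x - u x0)"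
      by (rule sphere_growth[OF sub u r \<alpha> _ nomax nonconst])
    then show "D / \<alpha> * r powr (1 + 1 / (1 + \<theta>)) \<le> (SUP x\<in>sphere x0 r. u x - u x0)"
      by (simp add: \<alpha>_def)
  qed
qed

end
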